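(* Let $\mathbb{A}=(A,(\mathrm{Con}_i)_{i\in A},(\vDash_i)_{i\in A})$ be a strong continuous information frame, and let $\mathcal{S}(\mathbb{A})=(A,\mathrm{CON},\Vdash)$ where $\mathrm{CON}=\{X\subseteq A \text{ finite}: \exists a\in A\,\exists \overline{X}\in\mathrm{Con}_a,\ X=\overline{X}\cup\{a\}\}$ and, for $X\in\mathrm{CON}$ and $c\in A$, $X\Vdash c$ iff there are $a\in A$ and $\overline{X}\in\mathrm{Con}_a$ with $X=\overline{X}\cup\{a\}$ and ($\overline{X}\vDash_a c$ or $\{a\}\vDash_a c$). Then $\mathcal{S}(\mathbb{A})$ is a continuous information system.
   Context: A continuous information system is a triple $(S,\mathrm{CON},\Vdash)$ with $S$ a set, $\mathrm{CON}$ a collection of finite subsets of $S$ and $\Vdash\subseteq\mathrm{CON}\times S$, such that for all $X,Y\in\mathrm{CON}$, $a\in S$ and finite $F\subseteq S$ (writing $X\Vdash Y$ iff $X\Vdash b$ for all $b\in Y$): (1) $\{a\}\in\mathrm{CON}$; (2) if $X\Vdash a$ then $X\cup\{a\}\in\mathrm{CON}$; (3) if $X\subseteq Y$ and $X\Vdash a$ then $Y\Vdash a$; (4) if $X\Vdash Y$ and $Y\Vdash a$ then $X\Vdash a$; (5) if $X\Vdash a$ then there is $Z\in\mathrm{CON}$ with $X\Vdash Z$ and $Z\Vdash a$; (6) if $X\Vdash F$ then there is $Z\in\mathrm{CON}$ with $F\subseteq Z$ and $X\Vdash Z$. A continuous information frame is a triple $\mathbb{A}=(A,(\mathrm{Con}_i)_{i\in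 A},(\vDash_i)_{i\in A})$ where $A$ is a set, each $\mathrm{Con}_i$ is a set of finite subsets of $A$, and $\vDash_i\subseteq\mathrm{Con}_i\times A$; write $iRj$ iff $\{i\}\in\mathrm{Con}_j$, and for finite $Y$, $X\vDash_i Y$ iff $X\vDash_i b$ for all $b\in Y$. Required, for all $i,j,a\in A$ and finite $X,Y\subseteq A$: (i) $\{i\}\in\mathrm{Con}_i$; (ii) if $Y\subseteq X\in\mathrm{Con}_i$ then $Y\in\mathrm{Con}_i$; (iii) if $X\in\mathrm{Con}_i$ and $X\vDash_i Y$ then $Y\in\mathrm{Con}_i$; (iv) if $X,Y\in\mathrm{Con}_i$, $X\subseteq Y$ and $X\vDash_i a$ then $Y\vDash_i a$; (v) if $X\in\mathrm{Con}_i$, $X\vDash_i Y$ and $Y\vDash_i a$ then $X\vDash_i a$; (vi) if $iRj$ then $\mathrm{Con}_i\subseteq\mathrm{Con}_j$; (vii) if $iRj$, $X\in\mathrm{Con}_i$ and $X\vDash_i a$ then $X\vDash_j a$; (viii) if $X\vDash_i Y$ then there exist $e\in A$ and $Z\in\mathrm{Con}_e$ with $X\vDash_i \{e\}\cup Z$ and $Z\vDash_e Y$. The frame is strong if for all $i\in A$ and $X\in\mathrm{Con}_i$ with $X\neq\{i\}$ we have $\{i\}\vDash_i X$. *)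

theory Defs
  imports Main
begin

definition entails_set :: "('a set \<Rightarrow> 'a \<Rightarrow> bool) \<Rightarrow> 'a set \<Rightarrow> 'a set \<Rightarrow> bool" where
  "entails_set R X Y \<longleftrightarrow> (\<forall>b\<in>Y. R X b)"

locale continuous_information_system =
  fixes S :: "'a set"
    and CON :: "'a set set"
    and ent :: "'a set \<Rightarrow> 'a \<Rightarrow> bool"
  assumes CON_finite_subset: "X \<in> CON \<Longrightarrow> finite X \<and> X \<subseteq> S"
    and ent_typed: "ent X a \<Longrightarrow> X \<in> CON \<and> a \<in> S"
    and singleton_CON: "a \<in> S \<Longrightarrow> {a} \<in> CON"
    and insert_CON: "\<lbrakk>X \<in> CON; a \<in> S; ent X a\<rbrakk> \<Longrightarrow> X \<union> {a} \<in> CON"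
    and ent_mono: "\<lbrakk>X \<in> CON; Y \<in> CON; a \<in> S; X \<subseteq> Y; ent X a\<rbrakk> \<Longrightarrow> ent Y a"
    and ent_trans: "\<lbrakk>X \<in> CON; Y \<in> CON; a \<in> S; entails_set ent X Y; ent Y a\<rbrakk> \<Longrightarrow> ent X a"
    and ent_interpolation:
      "\<lbrakk>X \<in> CON; a \<in> S; ent X a\<rbrakk> \<Longrightarrow> \<exists>Z\<in>CON. entails_set ent X Z \<and> ent Z a"
    and ent_finite_extension:
      "\<lbrakk>X \<in> CON; finite F; F \<subseteq> S; entails_set ent X F\<rbrakk>
        \<Longrightarrow> \<exists>Z\<in>CON. F \<subseteq> Z \<and> entails_set ent X Z"

definition frame_rel :: "('a \<Rightarrow> 'a set set) \<Rightarrow> 'a \<Rightarrow> 'a \<Rightarrow> bool" where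
  "frame_rel Con i j \<longleftrightarrow> {i} \<in> Con j"

text \<open>The families are total functions on the ambient type; only their values at indices in
  \<open>A\<close> are constrained. In \<open>frame_interpolation\<close> the premise \<open>X \<in> Con i\<close> is written out because
  the left-hand side of an entailment \<open>X \<Turnstile>\<^sub>i Y\<close> is a member of \<open>Con i\<close>, whereas
  \<open>entails_set\<close> is vacuously true for empty \<open>Y\<close>.\<close>

locale continuous_information_frame =
  fixes A :: "'a set"
    and Con :: "'a \<Rightarrow> 'a set set"
    and ent :: "'a \<Rightarrow> 'a set \<Rightarrow> 'a \<Rightarrow> bool"
  assumes Con_finite_subset: "\<lbrakk>i \<in> A; X \<in> Con i\<rbrakk> \<Longrightarrow> finite X \<and> X \<subseteq> A"
    and ent_typed: "\<lbrakk>i \<in> A; ent i X a\<rbrakk> \<Longrightarrow> X \<in> Con i \<and> a \<in> A"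
    and frame_self: "i \<in> A \<Longrightarrow> {i} \<in> Con i"
    and frame_down: "\<lbrakk>i \<in> A; X \<in> Con i; Y \<subseteq> X\<rbrakk> \<Longrightarrow> Y \<in> Con i"
    and frame_ent_Con:
      "\<lbrakk>i \<in> A; finite Y; Y \<subseteq> A; X \<in> Con i; entails_set (ent i) X Y\<rbrakk> \<Longrightarrow> Y \<in> Con i"
    and frame_weakening:
      "\<lbrakk>i \<in> A; a \<in> A; X \<in> Con i; Y \<in> Con i; X \<subseteq> Y; ent i X a\<rbrakk> \<Longrightarrow> ent i Y a"
    and frame_cut:
      "\<lbrakk>i \<in> A; a \<in> A; finite Y; Y \<subseteq> A; X \<in> Con i; entails_set (ent i) X Y; ent i Y a\<rbrakk>
        \<Longrightarrow> ent i X a"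
    and frame_Con_mono: "\<lbrakk>i \<in> A; j \<in> A; frame_rel Con i j\<rbrakk> \<Longrightarrow> Con i \<subseteq> Con j"
    and frame_ent_mono:
      "\<lbrakk>i \<in> A; j \<in> A; a \<in> A; frame_rel Con i j; X \<in> Con i; ent i X a\<rbrakk> \<Longrightarrow> ent j X a"
    and frame_interpolation:
      "\<lbrakk>i \<in> A; finite Y; Y \<subseteq> A; X \<in> Con i; entails_set (ent i) X Y\<rbrakk>
        \<Longrightarrow> \<exists>e\<in>A. \<exists>Z\<in>Con e. entails_set (ent i) X ({e} \<union> Z) \<and> entails_set (ent e) Z Y"

locale strong_continuous_information_frame = continuous_information_frame +
  assumes strong: "\<lbrakk>i \<in> A; X \<in> Con i; X \<noteq> {i}\<rbrakk> \<Longrightarrow> entails_set (ent i) {i} X"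

definition frame_CON :: "'a set \<Rightarrow> ('a \<Rightarrow> 'a set set) \<Rightarrow> 'a set set" where
  "frame_CON A Con = {X. X \<subseteq> A \<and> finite X \<and> (\<exists>a\<in>A. \<exists>X'\<in>Con a. X = X' \<union> {a})}"

definition frame_entails ::
  "'a set \<Rightarrow> ('a \<Rightarrow> 'a set set) \<Rightarrow> ('a \<Rightarrow> 'a set \<Rightarrow> 'a \<Rightarrow> bool) \<Rightarrow> 'a set \<Rightarrow> 'a \<Rightarrow> bool" where
  "frame_entails A Con ent X c \<longleftrightarrow>
    X \<in> frame_CON A Con \<and> c \<in> A \<and>
    (\<exists>a\<in>A. \<exists>X'\<in>Con a. X = X' \<union> {a} \<and> (ent a X' c \<or> ent a {a} c))"

end

theory Submission
  imports Defs
begin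

text \<open>Call \<open>a\<close> a witness of \<open>X\<close> if \<open>X = X' \<union> {a}\<close> for some \<open>X' \<in> Con a\<close>. Strongness gives
  \<open>{a} \<Turnstile>\<^sub>a X - {a}\<close>, so a witness alone entails all that \<open>X\<close> entails; moreover, whatever one
  witness entails is entailed by every other one. Thus \<open>X \<turnstile> c\<close> holds iff \<open>{a} \<Turnstile>\<^sub>a c\<close>
  for an arbitrary fixed witness \<open>a\<close> of \<open>X\<close>, and the axioms of an information
  system reduce to those of the frame at the index \<open>a\<close>.\<close>

text \<open>Deleting \<open>a\<close> picks the least possible \<open>X'\<close>, legitimate by
  downward closure of \<open>Con a\<close>. Since \<open>X - {a}\<close> never equals
  \<open>{a}\<close>, strongness always applies to it.\<close>

definition frame_witness :: "'a set \<Rightarrow> ('a \<Rightarrow> 'a set set) \<Rightarrow> 'a \<Rightarrow> 'a set \<Rightarrow> bool" where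
  "frame_witness A Con a X \<longleftrightarrow> a \<in> A \<and> a \<in> X \<and> X - {a} \<in> Con a"

context strong_continuous_information_frame
begin

lemma witnessI:
  assumes "a \<in> A" and "X' \<in> Con a"
  shows "frame_witness A Con a (X' \<union> {a})"
proof -
  have "(X' \<union> {a}) - {a} \<subseteq> X'" by blast
  then show ?thesis
    using assms frame_down unfolding frame_witness_def by blast
qed

lemma frame_CON_iff_witness: "X \<in> frame_CON A Con \<longleftrightarrow> (\<exists>a. frame_witness A Con a X)"
proof
  assume "X \<in> frame_CON A Con"
  then show "\<exists>a. frame_witness A Con a X"
    unfolding frame_CON_def using witnessI by blast
next
  assume "\<exists>a. frame_witness A Con a X"
  then obtain a where a: "a \<in> A" "a \<in> X" "X - {a} \<in> Con a"
    unfolding frame_witness_def by blast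
  then have "X = (X - {a}) \<union> {a}" and "finite (X - {a})" and "X - {a} \<subseteq> A"
    using Con_finite_subset by blast+
  then show "X \<in> frame_CON A Con"
    unfolding frame_CON_def using a by (auto intro!: bexI[of _ a] bexI[of _ "X - {a}"])
qed

text \<open>Strongness makes \<open>{i}\<close> entail all of \<open>X\<close> unless
  \<open>X = {i}\<close>; cut then removes \<open>X\<close>.\<close>

lemma ent_index:
  assumes "i \<in> A" and "X \<in> Con i" and "ent i X c"
  shows "ent i {i} c"
proof (cases "X = {i}")
  case False
  then have "entails_set (ent i) {i} X"
    using strong assms by blast
  moreover have "c \<in> A" "finite X" "X \<subseteq> A" "{i} \<in> Con i"
    using assms ent_typed Con_finite_subset frame_self by blast+
  ultimately show ?thesis
    using assms frame_cut[of i c X "{i}"] by blast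
qed (use assms in simp)

lemma witness_ent_others:
  assumes "frame_witness A Con a X"
  shows "entails_set (ent a) {a} (X - {a})"
  using assms strong[of a "X - {a}"] unfolding frame_witness_def by blast

lemma frame_entailsI:
  assumes "frame_witness A Con a X" and "ent a {a} c"
  shows "frame_entails A Con ent X c"
proof -
  have "a \<in> A" "X - {a} \<in> Con a" "X = (X - {a}) \<union> {a}"
    using assms(1) unfolding frame_witness_def by blast+
  then show ?thesis
    unfolding frame_entails_def
    using assms frame_CON_iff_witness ent_typed by blast
qed

lemma frame_entails_obtains_witness:
  assumes "frame_entails A Con ent X c"
  obtains a where "frame_witness A Con a X" and "ent a {a} c"
proof -
  obtain a X' where "a \<in> A" "X' \<in> Con a" "X = X' \<union> {a}" "ent a X' c \<or> ent a {a} c"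
    using assms unfolding frame_entails_def by blast
  then show thesis
    using that witnessI ent_index by blast
qed

text \<open>Since \<open>{i}\<close> entails \<open>j\<close> at \<open>i\<close>, the set
  \<open>{j}\<close> lies in \<open>Con i\<close>. So the relation \<open>frame_rel Con j i\<close>
  carries entailments from index \<open>j\<close> over to index \<open>i\<close>, where cut composes
  them.\<close>

lemma ent_index_trans:
  assumes "i \<in> A" and "j \<in> A" and "ent i {i} j" and "ent j {j} c"
  shows "ent i {i} c"
proof -
  have "c \<in> A" and self: "{i} \<in> Con i" "{j} \<in> Con j"
    using assms ent_typed frame_self by blast+
  have ij: "entails_set (ent i) {i} {j}"
    using assms by (simp add: entails_set_def)
  then have "frame_rel Con j i"
    unfolding frame_rel_def using frame_ent_Con[of i "{j}" "{i}"] assms self by simp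
  then have "ent i {j} c"
    using frame_ent_mono[of j i c "{j}"] assms self \<open>c \<in> A\<close> by simp
  then show ?thesis
    using frame_cut[of i c "{j}" "{i}"] assms self ij \<open>c \<in> A\<close> by simp
qed

text \<open>A witness \<open>a\<close> of \<open>X\<close> lies in \<open>Y\<close>, so it is
  \<open>b\<close> or is entailed by \<open>{b}\<close> at \<open>b\<close>. The case
  \<open>X = Y\<close> gives independence of the witness, the general case monotonicity.\<close>

lemma ent_of_witness:
  assumes "frame_entails A Con ent X c" and "X \<subseteq> Y" and b: "frame_witness A Con b Y"
  shows "ent b {b} c"
proof -
  obtain a where a: "frame_witness A Con a X" "ent a {a} c"
    using assms(1) by (rule frame_entails_obtains_witness)
  show ?thesis
  proof (cases "a = b")
    case False
    then have "a \<in> Y - {b}"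
      using a(1) assms(2) unfolding frame_witness_def by blast
    then have "ent b {b} a"
      using witness_ent_others[OF b] unfolding entails_set_def by blast
    then show ?thesis
      using ent_index_trans a b unfolding frame_witness_def by blast
  qed (use a in simp)
qed

lemma frame_entails_iff_witness:
  assumes "frame_witness A Con a X"
  shows "frame_entails A Con ent X c \<longleftrightarrow> ent a {a} c"
  using assms ent_of_witness frame_entailsI by blast

lemma witness_insert:
  assumes "frame_witness A Con a X" and "ent a {a} c"
  shows "frame_witness A Con a (X \<union> {c})"
proof -
  \<comment> \<open>When \<open>c = a\<close> this set contains \<open>a\<close> again; it is still
    entailed by \<open>{a}\<close>, hence in \<open>Con a\<close>.\<close>
  let ?Y = "(X - {a}) \<union> {c}"
  have a: "a \<in> A" "a \<in> X" "X - {a} \<in> Con a"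
    using assms unfolding frame_witness_def by blast+
  have "entails_set (ent a) {a} ?Y"
    using witness_ent_others[OF assms(1)] assms(2) by (auto simp: entails_set_def)
  moreover have "finite ?Y" "?Y \<subseteq> A"
    using a Con_finite_subset[of a "X - {a}"] ent_typed assms(2) by blast+
  ultimately have "?Y \<in> Con a"
    using frame_ent_Con[of a ?Y "{a}"] a(1) frame_self[of a] by blast
  then have "frame_witness A Con a (?Y \<union> {a})"
    using witnessI a by blast
  moreover have "?Y \<union> {a} = X \<union> {c}"
    using a by blast
  ultimately show ?thesis by simp
qed

text \<open>Common source of the last two axioms: \<open>Z \<union> {e}\<close> will interpolate a
  single conclusion, and \<open>F \<union> {e}\<close> will be the consistent extension of
  \<open>F\<close>.\<close>

lemma frame_entails_interpolation:
  assumes "X \<in> frame_CON A Con" and F: "finite F" "F \<subseteq> A"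
    and "entails_set (frame_entails A Con ent) X F"
  obtains e Z where "e \<in> A" and "Z \<in> Con e"
    and "entails_set (frame_entails A Con ent) X (Z \<union> {e})" and "entails_set (ent e) Z F"
proof -
  obtain a where a: "frame_witness A Con a X"
    using assms(1) frame_CON_iff_witness by blast
  then have "a \<in> A" and "entails_set (ent a) {a} F"
    using assms(4) by (auto simp: frame_witness_def entails_set_def frame_entails_iff_witness)
  then obtain e Z where "e \<in> A" "Z \<in> Con e" "entails_set (ent a) {a} ({e} \<union> Z)"
    "entails_set (ent e) Z F"
    using frame_interpolation[of a F "{a}"] F frame_self[of a] by blast
  then show thesis
    using that frame_entails_iff_witness[OF a] by (auto simp: entails_set_def)
qed

end

theorem theorem4p16:
  fixes A :: "'a set"
    and Con :: "'a \<Rightarrow> 'a set set"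
    and ent :: "'a \<Rightarrow> 'a set \<Rightarrow> 'a \<Rightarrow> bool"
  assumes "strong_continuous_information_frame A Con ent"
  shows "continuous_information_system A (frame_CON A Con) (frame_entails A Con ent)"
proof -
  interpret strong_continuous_information_frame A Con ent by (fact assms)
  let ?E = "frame_entails A Con ent"
  show ?thesis
  proof
    fix X assume "X \<in> frame_CON A Con"
    then show "finite X \<and> X \<subseteq> A" by (simp add: frame_CON_def)
  next
    fix X a assume "?E X a"
    then show "X \<in> frame_CON A Con \<and> a \<in> A" by (simp add: frame_entails_def)
  next
    fix a assume "a \<in> A"
    then show "{a} \<in> frame_CON A Con"
      using witnessI[of a "{a}"] frame_self frame_CON_iff_witness by auto
  next
    fix X a assume "?E X a"
    then show "X \<union> {a} \<in> frame_CON A Con"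
      by (blast intro: witness_insert frame_CON_iff_witness[THEN iffD2]
          elim: frame_entails_obtains_witness)
  next
    fix X Y a assume "Y \<in> frame_CON A Con" "X \<subseteq> Y" "?E X a"
    then show "?E Y a"
      using frame_CON_iff_witness ent_of_witness frame_entailsI by blast
  next
    fix X Y c assume "X \<in> frame_CON A Con" and XY: "entails_set ?E X Y" and "?E Y c"
    obtain a where a: "frame_witness A Con a X"
      using \<open>X \<in> frame_CON A Con\<close> frame_CON_iff_witness by blast
    obtain b where b: "frame_witness A Con b Y" "ent b {b} c"
      using \<open>?E Y c\<close> by (rule frame_entails_obtains_witness)
    \<comment> \<open>The witness \<open>b\<close> is an element of \<open>Y\<close>, so
      \<open>X\<close> entails it.\<close>
    then have "ent a {a} b"
      using XY frame_entails_iff_witness[OF a] by (simp add: entails_set_def frame_witness_def)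
    then show "?E X c"
      using a b ent_index_trans frame_entailsI unfolding frame_witness_def by blast
  next
    fix X c assume "X \<in> frame_CON A Con" "c \<in> A" "?E X c"
    then obtain e Z where e: "e \<in> A" "Z \<in> Con e" "entails_set ?E X (Z \<union> {e})" "ent e Z c"
      using frame_entails_interpolation[of X "{c}"] by (auto simp: entails_set_def)
    then have "frame_witness A Con e (Z \<union> {e})" "ent e {e} c"
      using witnessI ent_index by blast+
    then show "\<exists>Z\<in>frame_CON A Con. entails_set ?E X Z \<and> ?E Z c"
      using e(3) frame_entailsI frame_CON_iff_witness by blast
  next
    fix X F assume X: "X \<in> frame_CON A Con" and F: "finite F" "F \<subseteq> A" and XF: "entails_set ?E X F"
    then obtain e Z where e: "e \<in> A" "Z \<in> Con e" "entails_set ?E X (Z \<union> {e})"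
      "entails_set (ent e) Z F"
      by (rule frame_entails_interpolation)
    \<comment> \<open>\<open>Z\<close> entails \<open>F\<close> at \<open>e\<close>, so closure of
      \<open>Con e\<close> under entailment makes \<open>e\<close> a witness of
      \<open>F \<union> {e}\<close>.\<close>
    then have "F \<in> Con e"
      using frame_ent_Con F by blast
    then have "F \<union> {e} \<in> frame_CON A Con"
      using witnessI e(1) frame_CON_iff_witness by blast
    moreover have "entails_set ?E X (F \<union> {e})"
      using e(3) XF by (auto simp: entails_set_def)
    ultimately show "\<exists>Z\<in>frame_CON A Con. F \<subseteq> Z \<and> entails_set ?E X Z"
      by blast
  qed
qed

end
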